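(* For any graph $G$ of order $n$, $n+1\leqslant \chi_{\square}(G)+\chi_{\square}(\overline{G})\leqslant 2n$; equivalently, $n+1\leqslant \chi(G^2)+\chi(\overline{G}^2)\leqslant 2n$.
   Context: All graphs are finite and simple; the order of a graph is its number of vertices, and $\overline{G}$ denotes the complement of $G$. For a graph $G$, $d(u,v)$ is the length of a shortest $(u,v)$-path in $G$. A mapping $f:V(G)\to\{1,\ldots,k\}$ is a square $k$-coloring of $G$ if $f(u)\neq f(v)$ whenever $u\neq v$ and $d(u,v)\leqslant 2$. The square chromatic number $\chi_{\square}(G)$ is the minimum such $k$. The square graph $G^2$ is obtained from $G$ by adding an edge between every pair of vertices at distance 2 in $G$; thus $\chi_{\square}(G)=\chi(G^2)$, where $\chi$ is the ordinary chromatic number. Here $\overline{G}^2$ means the square of $\overline{G}$. *)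

theory Defs
  imports "Graph_Theory.Shortest_Path" "Graph_Theory.Pair_Digraph"
begin

text \<open>
  A finite simple graph is a \<^locale>\<open>pair_graph\<close>: a finite, loop-free, symmetric digraph
  without parallel arcs, so that an edge \<open>uv\<close> is the pair of arcs \<open>(u,v)\<close>, \<open>(v,u)\<close>.
\<close>

text \<open>
  The library's \<open>\<mu>\<close> takes the infimum over walks, which for unit costs is the length of a shortest
  path (\<open>gdist_eq_shortest_path\<close> below). Its value is \<open>\<infinity>\<close> if there is no \<open>(u,v)\<close>-path.
\<close>
definition gdist :: "'a pair_pre_digraph \<Rightarrow> 'a \<Rightarrow> 'a \<Rightarrow> ereal" where
  "gdist G u v = wf_digraph.\<mu> (with_proj G) (\<lambda>_. 1) u v"

definition complement_graph :: "'a pair_pre_digraph \<Rightarrow> 'a pair_pre_digraph" where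
  "complement_graph G = \<lparr> pverts = pverts G,
     parcs = {(u, v). u \<in> pverts G \<and> v \<in> pverts G \<and> u \<noteq> v \<and> (u, v) \<notin> parcs G} \<rparr>"

definition square_graph :: "'a pair_pre_digraph \<Rightarrow> 'a pair_pre_digraph" where
  "square_graph G = \<lparr> pverts = pverts G,
     parcs = parcs G \<union> {(u, v). u \<in> pverts G \<and> v \<in> pverts G \<and> gdist G u v = 2} \<rparr>"

definition proper_coloring :: "'a pair_pre_digraph \<Rightarrow> nat \<Rightarrow> ('a \<Rightarrow> nat) \<Rightarrow> bool" where
  "proper_coloring G k f \<longleftrightarrow>
     f ` pverts G \<subseteq> {1..k} \<and> (\<forall>(u, v) \<in> parcs G. f u \<noteq> f v)"

definition chromatic_number :: "'a pair_pre_digraph \<Rightarrow> nat" where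
  "chromatic_number G = (LEAST k. \<exists>f. proper_coloring G k f)"

definition square_coloring :: "'a pair_pre_digraph \<Rightarrow> nat \<Rightarrow> ('a \<Rightarrow> nat) \<Rightarrow> bool" where
  "square_coloring G k f \<longleftrightarrow>
     f ` pverts G \<subseteq> {1..k} \<and>
     (\<forall>u \<in> pverts G. \<forall>v \<in> pverts G. u \<noteq> v \<and> gdist G u v \<le> 2 \<longrightarrow> f u \<noteq> f v)"

definition square_chromatic_number :: "'a pair_pre_digraph \<Rightarrow> nat" where
  "square_chromatic_number G = (LEAST k. \<exists>f. square_coloring G k f)"

context pair_graph
begin

lemma awalk_cost_unit: "awalk_cost (\<lambda>_. 1) p = real (length p)"
  by (induct p) auto

lemma gdist_unfold: "gdist G u v = (INF p \<in> {p. awalk u p v}. ereal (real (length p)))"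
  unfolding gdist_def \<mu>_def awalk_cost_unit ..

lemma gdist_eq_shortest_path:
  "gdist G u v = (INF p \<in> {p. apath u p v}. ereal (real (length p)))"
proof (rule antisym)
  show "gdist G u v \<le> (INF p \<in> {p. apath u p v}. ereal (real (length p)))"
    unfolding gdist_unfold by (rule INF_superset_mono) (auto intro: awalkI_apath)
  show "(INF p \<in> {p. apath u p v}. ereal (real (length p))) \<le> gdist G u v"
    unfolding gdist_unfold
  proof (rule INF_greatest)
    fix p assume "p \<in> {p. awalk u p v}"
    then have p: "awalk u p v" by simp
    have "apath u (awalk_to_apath p) v" using p by (rule apath_awalk_to_apath)
    moreover have "awalk_cost (\<lambda>_. 1) (awalk_to_apath p) \<le> awalk_cost (\<lambda>_. 1) p"
      using p by (rule awalk_to_path_no_neg_cyc_cost) (simp add: awalk_cost_unit)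
    then have "length (awalk_to_apath p) \<le> length p" by (simp add: awalk_cost_unit)
    ultimately show "(INF p \<in> {p. apath u p v}. ereal (real (length p))) \<le> ereal (real (length p))"
      by (auto intro!: INF_lower2)
  qed
qed

lemma gdist_attained:
  assumes "gdist G u v \<noteq> \<infinity>"
  obtains p where "apath u p v" "gdist G u v = ereal (real (length p))"
proof -
  let ?S = "{p. apath u p v}"
  have "?S \<noteq> {}"
  proof
    assume "?S = {}"
    then have "gdist G u v = \<infinity>"
      unfolding gdist_eq_shortest_path by (simp only: image_empty Inf_empty top_ereal_def)
    with assms show False ..
  qed
  then obtain p0 where p0: "apath u p0 v" by blast
  define p where "p = arg_min length (\<lambda>p. apath u p v)"
  have p: "apath u p v"
    unfolding p_def using p0 by (rule arg_min_natI)
  have "length p \<le> length q" if "apath u q v" for q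
    unfolding p_def using that by (rule arg_min_nat_le)
  then have "gdist G u v = ereal (real (length p))"
    unfolding gdist_eq_shortest_path using p by (intro INF_eqI) auto
  with p that show thesis by blast
qed

lemma gdist_le_1:
  assumes "(u, v) \<in> parcs G"
  shows "gdist G u v \<le> 1"
proof -
  have "awalk u [(u, v)] v"
    using assms arc_fst_in_verts[OF assms] by (auto simp: awalk_def)
  then have "gdist G u v \<le> ereal (real (length [(u, v)]))"
    unfolding gdist_unfold by (intro INF_lower) simp
  then show ?thesis by (simp add: one_ereal_def)
qed

lemma gdist_le_2_cases:
  assumes "gdist G u v \<le> 2"
  shows "u = v \<or> (u, v) \<in> parcs G \<or> gdist G u v = 2"
proof -
  have "gdist G u v \<noteq> \<infinity>" using assms by auto
  then obtain p where p: "apath u p v" "gdist G u v = ereal (real (length p))"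
    by (rule gdist_attained)
  from assms p(2) have "ereal (real (length p)) \<le> ereal 2" by simp
  then have "length p \<le> 2" by simp
  then consider "length p = 0" | "length p = 1" | "length p = 2" by linarith
  then show ?thesis
  proof cases
    case 1
    with p(1) show ?thesis by (auto simp: apath_def awalk_def)
  next
    case 2
    then obtain e where "p = [e]" by (auto simp: length_Suc_conv)
    with p(1) show ?thesis by (cases e) (auto simp: apath_def awalk_def)
  next
    case 3
    with p(2) show ?thesis by simp
  qed
qed

lemma gdist_self: "u \<in> pverts G \<Longrightarrow> gdist G u u \<le> 0"
proof -
  assume "u \<in> pverts G"
  then have "awalk u [] u" by (simp add: awalk_def)
  then have "gdist G u u \<le> ereal (real (length ([] :: ('a \<times> 'a) list)))"
    unfolding gdist_unfold by (intro INF_lower) simp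
  then show ?thesis by (simp add: zero_ereal_def)
qed

lemma square_coloring_iff: "square_coloring G k f \<longleftrightarrow> proper_coloring (square_graph G) k f"
proof -
  have "(u \<noteq> v \<and> gdist G u v \<le> 2) \<longleftrightarrow> (u, v) \<in> parcs G \<or> gdist G u v = 2"
    if "u \<in> pverts G" "v \<in> pverts G" for u v
  proof
    assume "u \<noteq> v \<and> gdist G u v \<le> 2"
    then show "(u, v) \<in> parcs G \<or> gdist G u v = 2" using gdist_le_2_cases by blast
  next
    assume *: "(u, v) \<in> parcs G \<or> gdist G u v = 2"
    have "(1::ereal) \<le> 2" by simp
    then have "gdist G u v \<le> 2" using * gdist_le_1 order_trans by fastforce
    moreover have "u \<noteq> v" using * no_loops' gdist_self[OF that(1)] by force
    ultimately show "u \<noteq> v \<and> gdist G u v \<le> 2" by blast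
  qed
  then have "(\<forall>u \<in> pverts G. \<forall>v \<in> pverts G. u \<noteq> v \<and> gdist G u v \<le> 2 \<longrightarrow> f u \<noteq> f v) \<longleftrightarrow>
    (\<forall>u \<in> pverts G. \<forall>v \<in> pverts G. (u, v) \<in> parcs G \<or> gdist G u v = 2 \<longrightarrow> f u \<noteq> f v)"
    by (metis (no_types, lifting))
  also have "\<dots> \<longleftrightarrow> (\<forall>(u, v) \<in> parcs (square_graph G). f u \<noteq> f v)"
    using wellformed' by (simp add: square_graph_def) blast
  finally show ?thesis
    unfolding square_coloring_def proper_coloring_def by (simp add: square_graph_def)
qed

lemma square_chromatic_number_eq: "square_chromatic_number G = chromatic_number (square_graph G)"
  unfolding square_chromatic_number_def chromatic_number_def square_coloring_iff ..

lemma gdist_commute: "gdist G u v = gdist G v u"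
proof -
  have le: "gdist G y x \<le> gdist G x y" for x y
    unfolding gdist_unfold
  proof (rule INF_mono)
    fix p assume "p \<in> {p. awalk x p y}"
    then have "awalk y (rev_path p) x" by (simp add: awalk_rev_path)
    moreover have "length (rev_path p) = length p" by (induct p) auto
    ultimately show "\<exists>q \<in> {p. awalk y p x}. ereal (real (length q)) \<le> ereal (real (length p))"
      by (intro bexI[of _ "rev_path p"]) auto
  qed
  show ?thesis by (rule antisym) (rule le)+
qed

lemma pair_graph_complement: "pair_graph (complement_graph G)"
proof unfold_locales
  show "finite (parcs (complement_graph G))"
    by (rule finite_subset[of _ "pverts G \<times> pverts G"]) (auto simp: complement_graph_def)
  have "sym (parcs (complement_graph G))"
    by (rule symI) (use arcs_symmetric in \<open>auto simp: complement_graph_def\<close>)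
  then show "symmetric (with_proj (complement_graph G))"
    by (simp add: symmetric_def)
qed (auto simp: complement_graph_def)

lemma pair_graph_square: "pair_graph (square_graph G)"
proof unfold_locales
  show "finite (parcs (square_graph G))"
    by (rule finite_subset[of _ "pverts G \<times> pverts G"])
      (auto simp: square_graph_def dest: wellformed')
  show "fst e \<noteq> snd e" if e: "e \<in> parcs (square_graph G)" for e
  proof
    assume "fst e = snd e"
    then obtain u where "e = (u, u)" by (cases e) simp
    with e have "u \<in> pverts G" "gdist G u u = 2"
      using no_loops' by (auto simp: square_graph_def)
    with gdist_self[of u] show False by simp
  qed
  have "sym (parcs (square_graph G))"
    by (rule symI) (use arcs_symmetric gdist_commute in \<open>auto simp: square_graph_def\<close>)
  then show "symmetric (with_proj (square_graph G))"
    by (simp add: symmetric_def)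
qed (auto simp: square_graph_def dest: wellformed')

end

end

(* Two vertices of G with the same colour are at distance at least 3 in G, so in the complement they
   are adjacent and every other vertex is adjacent to one of them. Hence a vertex u that shares its
   colour in a square colouring f of G shares its colour with no vertex in a square colouring g of the
   complement. If A is the set of vertices that share their f-colour, then g needs at least |A| colours,
   and f needs at least n - |A| of them, plus one more for A if A is nonempty. *)
theory Submission
  imports Defs
begin

text \<open>Giving all vertices different colours is always admissible. This yields the upper bound
  by the order, and it also guarantees that the \<open>LEAST\<close> in
  \<open>square_chromatic_number\<close> is attained.\<close>

lemma ex_square_coloring_card:
  assumes "finite (pverts G)"
  shows "\<exists>f. square_coloring G (card (pverts G)) f"
proof -
  obtain f where "bij_betw f (pverts G) {1..card (pverts G)}"
    using finite_same_card_bij[OF assms, of "{1..card (pverts G)}"] by auto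
  then have "square_coloring G (card (pverts G)) f"
    by (auto simp: square_coloring_def bij_betw_def inj_on_def)
  then show ?thesis by blast
qed

lemma square_chromatic_number_le_card:
  "finite (pverts G) \<Longrightarrow> square_chromatic_number G \<le> card (pverts G)"
  unfolding square_chromatic_number_def by (intro Least_le ex_square_coloring_card)

lemma obtain_optimal_square_coloring:
  assumes "finite (pverts G)"
  obtains f where "square_coloring G (square_chromatic_number G) f"
  using LeastI[of "\<lambda>k. \<exists>f. square_coloring G k f", OF ex_square_coloring_card[OF assms]]
  unfolding square_chromatic_number_def by blast

lemma square_coloring_card_image_le:
  assumes "square_coloring G k f" "S \<subseteq> pverts G"
  shows "card (f ` S) \<le> k"
proof -
  have "card (f ` S) \<le> card {1..k}"
    using assms by (intro card_mono) (auto simp: square_coloring_def)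
  then show ?thesis by simp
qed

context pair_graph
begin

lemma gdist_le_2:
  assumes "(u, w) \<in> parcs G" "(w, v) \<in> parcs G"
  shows "gdist G u v \<le> 2"
proof -
  have "awalk u [(u, w), (w, v)] v"
    using assms wellformed' by (auto simp: awalk_def)
  then have "gdist G u v \<le> ereal (real (length [(u, w), (w, v)]))"
    unfolding gdist_unfold by (intro INF_lower) simp
  then show ?thesis by simp
qed

text \<open>Equal colours force distance greater than 2, which excludes walks of length 1 and of
  length 2 between \<open>u\<close> and \<open>v\<close>.\<close>

lemma square_coloring_eqD:
  assumes "square_coloring G k f" "u \<in> pverts G" "v \<in> pverts G" "u \<noteq> v" "f u = f v"
  shows "(u, v) \<notin> parcs G" "(u, w) \<in> parcs G \<Longrightarrow> (w, v) \<notin> parcs G"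
proof -
  have *: "\<not> gdist G u v \<le> 2"
    using assms by (auto simp: square_coloring_def)
  have "(1::ereal) \<le> 2" by simp
  with * show "(u, v) \<notin> parcs G"
    using gdist_le_1 order_trans by blast
  from * show "(u, w) \<in> parcs G \<Longrightarrow> (w, v) \<notin> parcs G"
    using gdist_le_2 by blast
qed

text \<open>If \<open>w\<close> differed from \<open>u\<close>, then \<open>u\<close> and
  \<open>w\<close> would be far apart in the complement, hence adjacent in \<open>G\<close>. As
  \<open>u\<close> and \<open>v\<close> have no common neighbour in \<open>G\<close>,
  \<open>v\<close> would be adjacent to neither \<open>u\<close> nor \<open>w\<close> there, so
  \<open>u\<close>, \<open>v\<close>, \<open>w\<close> would be a path of length 2 in the
  complement.\<close>

lemma square_coloring_complement_unique:
  assumes f: "square_coloring G k f" and g: "square_coloring (complement_graph G) l g"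
    and V: "u \<in> pverts G" "v \<in> pverts G" "w \<in> pverts G"
    and uv: "u \<noteq> v" "f u = f v" and gw: "g u = g w"
  shows "w = u"
proof (rule ccontr)
  assume "w \<noteq> u"
  interpret C: pair_graph "complement_graph G" by (rule pair_graph_complement)
  have "u \<in> pverts (complement_graph G)" "w \<in> pverts (complement_graph G)"
    using V by (simp_all add: complement_graph_def)
  note sep = C.square_coloring_eqD[OF g this \<open>w \<noteq> u\<close>[symmetric] gw]
  have uw: "(u, w) \<in> parcs G"
    using sep(1) V \<open>w \<noteq> u\<close> by (auto simp: complement_graph_def)
  have uv': "(u, v) \<notin> parcs G"
    using f V(1,2) uv by (rule square_coloring_eqD)
  have "(w, v) \<notin> parcs G"
    using square_coloring_eqD(2)[OF f V(1,2) uv uw] .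
  then have "(v, w) \<notin> parcs G"
    using arcs_symmetric by blast
  \<comment> \<open>Arcs of the complement join distinct vertices, so this case has to be excluded
    first.\<close>
  moreover have "v \<noteq> w" using uw uv' by blast
  ultimately have "(u, v) \<in> parcs (complement_graph G)" "(v, w) \<in> parcs (complement_graph G)"
    using V uv(1) uv' by (auto simp: complement_graph_def)
  with sep(2) show False by blast
qed

lemma square_colorings_lower_bound:
  assumes f: "square_coloring G k f" and g: "square_coloring (complement_graph G) l g"
    and ne: "pverts G \<noteq> {}"
  shows "card (pverts G) + 1 \<le> k + l"
proof -
  let ?V = "pverts G"
  have Vc: "pverts (complement_graph G) = ?V"
    by (simp add: complement_graph_def)
  define A where "A = {u \<in> ?V. \<exists>v \<in> ?V. u \<noteq> v \<and> f u = f v}"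
  have AV: "A \<subseteq> ?V" by (auto simp: A_def)
  show ?thesis
  proof (cases "A = {}")
    case True
    then have "inj_on f ?V" by (auto simp: A_def inj_on_def)
    then have "card ?V \<le> k"
      using square_coloring_card_image_le[OF f order_refl] by (simp add: card_image)
    \<comment> \<open>Here the extra 1 comes from the complement: a nonempty vertex set needs at
      least one colour.\<close>
    moreover have "1 \<le> l"
      using g ne by (auto simp: square_coloring_def Vc)
    ultimately show ?thesis by simp
  next
    case False
    then obtain a where a: "a \<in> A" by blast
    \<comment> \<open>Each element of \<open>A\<close> has a partner of the same
      \<open>f\<close>-colour, which plays the role of \<open>v\<close> in the uniqueness
      lemma.\<close>
    have "inj_on g A"
      using square_coloring_complement_unique[OF f g] unfolding inj_on_def A_def by blast
    then have l: "card A \<le> l"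
      using square_coloring_card_image_le[OF g, of A] AV by (simp add: card_image Vc)
    \<comment> \<open>Only \<open>x\<close> has to lie outside \<open>A\<close>, so \<open>y\<close>
      may be the representative \<open>a\<close>. Thus \<open>f\<close> stays injective when
      \<open>a\<close> is added to \<open>?V - A\<close>, and this supplies the extra 1.\<close>
    have sing: "x = y" if "x \<in> ?V - A" "y \<in> ?V" "f x = f y" for x y
      using that by (auto simp: A_def)
    have "inj_on f (insert a (?V - A))"
      using sing a AV by (intro inj_onI) (metis insertE subsetD DiffD1)
    then have "card (insert a (?V - A)) \<le> k"
      using square_coloring_card_image_le[OF f, of "insert a (?V - A)"] a AV
      by (simp only: card_image) blast
    then have "card (?V - A) + 1 \<le> k"
      using a by simp
    \<comment> \<open>The second fact ensures that the subtraction of naturals is not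
      truncated.\<close>
    moreover have "card (?V - A) = card ?V - card A" "card A \<le> card ?V"
      using AV finite_subset[OF AV] by (simp_all add: card_Diff_subset card_mono)
    ultimately show ?thesis using l by linarith
  qed
qed

end

theorem theorem8:
  fixes G :: "'a pair_pre_digraph" and n :: nat
  assumes "pair_graph G"
    and "pverts G \<noteq> {}"
    and "n = card (pverts G)"
  shows "(n + 1 \<le> square_chromatic_number G + square_chromatic_number (complement_graph G) \<and>
          square_chromatic_number G + square_chromatic_number (complement_graph G) \<le> 2 * n) \<and>
         (n + 1 \<le> chromatic_number (square_graph G) + chromatic_number (square_graph (complement_graph G)) \<and>
          chromatic_number (square_graph G) + chromatic_number (square_graph (complement_graph G)) \<le> 2 * n)"
proof -
  interpret pair_graph G by fact
  interpret C: pair_graph "complement_graph G" by (rule pair_graph_complement)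
  have n: "n = card (pverts (complement_graph G))"
    using assms(3) by (simp add: complement_graph_def)
  obtain f g where "square_coloring G (square_chromatic_number G) f"
    "square_coloring (complement_graph G) (square_chromatic_number (complement_graph G)) g"
    using obtain_optimal_square_coloring[OF finite_verts]
      obtain_optimal_square_coloring[OF C.finite_verts] by metis
  then have "n + 1 \<le> square_chromatic_number G + square_chromatic_number (complement_graph G)"
    using square_colorings_lower_bound assms(2,3) by blast
  moreover have "square_chromatic_number G \<le> n" "square_chromatic_number (complement_graph G) \<le> n"
    using square_chromatic_number_le_card[OF finite_verts] assms(3)
      square_chromatic_number_le_card[OF C.finite_verts] n by simp_all
  ultimately show ?thesis
    by (simp flip: square_chromatic_number_eq C.square_chromatic_number_eq)
qed

end
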